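(* Assume that the parent distribution is supported on some (possibly unbounded) interval $(a,b)$ with density $f>0$ on $(a,b)$. (1) If $\mathbb{E}|X_{1:2}|<\infty$ and $\mathbb{E}(X_{1:2}\mid X_{2:4})=X_{2:4}$ almost surely, then the quantile density satisfies $q(u)\propto\dfrac{1+u}{u^{5/4}(1-u)^{5/2}}$, $u\in(0,1)$. (2) If $\mathbb{E}|X_{2:2}|<\infty$ and $\mathbb{E}(X_{2:2}\mid X_{3:4})=X_{3:4}$ almost surely, then the quantile density satisfies $q(u)\propto\dfrac{2-u}{u^{5/2}(1-u)^{5/4}}$, $u\in(0,1)$.
   Context: $X_1,X_2,X_3,X_4$ are independent identically distributed real random variables with cumulative distribution function $F$ (the parent distribution), absolutely continuous with respect to Lebesgue measure with density $f$. $X_{i:m}$ denotes the $i$-th smallest among $X_1,\ldots,X_m$. If $f$ is strictly positive on an interval $(a,b)$ carrying the distribution, then $F$ is invertible on $(a,b)$; its inverse $Q:(0,1)\to(a,b)$ is the quantile function and $q=Q'$ is the quantile density. Equivalently, $f=T(F)$ on $(a,b)$ if and only if $q=1/T$ on $(0,1)$. The symbol $\propto$ means equality up to a positive multiplicative constant. *)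

theory Defs
  imports "HOL-Probability.Probability"
begin

(* X_{i:m}: i counts from 1 and the sample is X 1, ..., X m; list indexing starts at 0.
   Meaningful for 1 <= i <= m. *)
definition order_stat :: "nat \<Rightarrow> nat \<Rightarrow> (nat \<Rightarrow> 'a \<Rightarrow> real) \<Rightarrow> 'a \<Rightarrow> real" where
  "order_stat i m X \<omega> = sort (map (\<lambda>j. X j \<omega>) [1..<Suc m]) ! (i - 1)"

(* E(Z | Y) as a random variable on M, i.e. conditional on the sigma-algebra generated by Y. *)
definition cond_exp_given :: "'a measure \<Rightarrow> ('a \<Rightarrow> real) \<Rightarrow> ('a \<Rightarrow> real) \<Rightarrow> 'a \<Rightarrow> real" where
  "cond_exp_given M Z Y = real_cond_exp M (vimage_algebra (space M) Y borel) Z"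

(* The inverse of F restricted to (a,b), with a, b possibly infinite. *)
definition quantile_fun :: "(real \<Rightarrow> real) \<Rightarrow> ereal \<Rightarrow> ereal \<Rightarrow> real \<Rightarrow> real" where
  "quantile_fun F a b = the_inv_into (einterval a b) F"

end

theory Submission
  imports Defs
begin

text \<open>
  Let \<open>G y = E (y - X\<^sub>1)\<^sup>+\<close> and \<open>K y = E (min X\<^sub>1 X\<^sub>2 - y)\<^sup>+\<close>, so that \<open>G' = F\<close> and
  \<open>K' = - (1 - F)\<^sup>2\<close>. Splitting according to which sample points are the smallest and the second
  smallest of the four, the condition on \<open>E (X\<^bsub>1:2\<^esub> | X\<^bsub>2:4\<^esub>)\<close> becomes
  \<open>F K = 3 (1 - F)\<^sup>2 G\<close> on \<open>{0 < F < 1}\<close>. No smoothness of \<open>F\<close> is known beforehand, but \<open>K / G\<close> is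
  continuously differentiable with nonvanishing derivative and \<open>(K / G) (Q u) = 3 (1 - u)\<^sup>2 / u\<close>;
  this makes \<open>Q\<close> differentiable with \<open>Q' = (3/4) (1 + u) g / ((1 - u) u\<^sup>2)\<close> for \<open>g = G \<circ> Q\<close>. As
  \<open>g' = u Q'\<close>, this is a linear differential equation with solution
  \<open>g = C u\<^bsup>3/4\<^esup> (1 - u)\<^bsup>-3/2\<^esup>\<close>. The second statement follows by passing to \<open>-X\<close>.
\<close>

section \<open>The differential equation for the quantile function\<close>

text \<open>A one-dimensional inverse-function argument in which \<open>Q\<close> is known only to
  be continuous. In Caratheodory form the increment of \<open>R\<close> at \<open>Q u\<close> is
  \<open>g z * (z - Q u)\<close> with \<open>g\<close> continuous there, so the difference quotient
  of \<open>p\<close> is \<open>g (Q v)\<close> times that of \<open>Q\<close>; near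
  \<open>u\<close> one may divide because \<open>g (Q v)\<close> tends to \<open>D\<close>, which is
  nonzero.\<close>

lemma DERIV_factor_through:
  fixes R Q p :: "real \<Rightarrow> real"
  assumes Q: "isCont Q u"
    and R: "(R has_real_derivative D) (at (Q u))" and "D \<noteq> 0"
    and p: "(p has_real_derivative E) (at u)"
    and eq: "\<forall>\<^sub>F v in at u. R (Q v) = p v" and eq_u: "R (Q u) = p u"
  shows "(Q has_real_derivative E / D) (at u)"
proof -
  obtain g where g: "\<And>z. R z - R (Q u) = g z * (z - Q u)" "isCont g (Q u)" "g (Q u) = D"
    using R unfolding CARAT_DERIV by blast
  have lim: "((\<lambda>v. g (Q v)) \<longlongrightarrow> D) (at u)"
    using isCont_tendsto_compose[OF g(2)] Q g(3) by (simp add: isCont_def)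
  have "((\<lambda>v. (p v - p u) / (v - u) / g (Q v)) \<longlongrightarrow> E / D) (at u)"
    using p lim \<open>D \<noteq> 0\<close> by (intro tendsto_divide) (auto simp: has_field_derivative_iff)
  moreover have "\<forall>\<^sub>F v in at u. g (Q v) \<noteq> 0"
    using tendsto_imp_eventually_ne[OF lim \<open>D \<noteq> 0\<close>] .
  then have "\<forall>\<^sub>F v in at u. (p v - p u) / (v - u) / g (Q v) = (Q v - Q u) / (v - u)"
    using eq
  proof eventually_elim
    case (elim v)
    then have "p v - p u = g (Q v) * (Q v - Q u)"
      using g(1)[of "Q v"] eq_u by simp
    with elim show ?case by simp
  qed
  ultimately show ?thesis
    unfolding has_field_derivative_iff by (rule Lim_transform_eventually)
qed

text \<open>The intermediate value theorem, fed by the limits 0 and 1, shows that every level in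
  (0,1) is attained, and the point is automatically in \<open>S\<close>. Since \<open>S\<close> is
  open, a closed ball around that point lies in it, and the inverse of a continuous injection on
  this ball is continuous.\<close>

lemma strict_mono_cdf_inverse:
  fixes F :: "real \<Rightarrow> real"
  defines "S \<equiv> {x. 0 < F x \<and> F x < 1}"
  assumes cont: "continuous_on UNIV F" and mono: "strict_mono_on S F"
    and bot: "(F \<longlongrightarrow> 0) at_bot" and top: "(F \<longlongrightarrow> 1) at_top" and u: "0 < u" "u < 1"
  shows "the_inv_into S F u \<in> S" "F (the_inv_into S F u) = u" "isCont (the_inv_into S F) u"
proof -
  have inj: "inj_on F S" using mono by (rule strict_mono_on_imp_inj_on)
  obtain x where x: "F x < u" using order_tendstoD(2)[OF bot u(1)] by (auto simp: eventually_at_bot_linorder)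
  obtain y' where y': "\<And>z. y' \<le> z \<Longrightarrow> u < F z"
    using order_tendstoD(1)[OF top u(2)] by (auto simp: eventually_at_top_linorder)
  \<comment> \<open>The maximum with \<open>x\<close> keeps \<open>x \<le> y\<close>, so that
    \<open>[x, y]\<close> is a legitimate interval for the intermediate value theorem.\<close>
  define y where "y = max y' x"
  have "\<exists>z. x \<le> z \<and> z \<le> y \<and> F z = u"
    by (rule IVT') (use x y'[of y] cont in \<open>auto simp: y_def intro: continuous_on_subset less_imp_le\<close>)
  then obtain z where z: "F z = u" by blast
  with u have zS: "z \<in> S" by (simp add: S_def)
  have inv: "the_inv_into S F (F w) = w" if "w \<in> S" for w
    using inj that by (rule the_inv_into_f_f)
  show "the_inv_into S F u \<in> S" "F (the_inv_into S F u) = u"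
    using inv[OF zS] z zS by auto
  have "open S" unfolding S_def
    by (intro open_Collect_conj open_Collect_less continuous_intros cont)
  then obtain d where d: "d > 0" "cball z d \<subseteq> S" using zS open_contains_cball by blast
  have "the_inv_into S F (F w) = w" if "\<bar>w - z\<bar> \<le> d" for w
  proof -
    from that have "w \<in> cball z d" by (simp add: dist_real_def abs_minus_commute)
    with d(2) inv show ?thesis by blast
  qed
  moreover have "isCont F w" for w using cont by (simp add: continuous_on_eq_continuous_at)
  ultimately have "isCont (the_inv_into S F) (F z)"
    using isCont_inverse_function[OF d(1), of z "the_inv_into S F" F] by blast
  then show "isCont (the_inv_into S F) u" by (simp add: z)
qed

lemma quantile_derivative_ODE:
  fixes F G K Q :: "real \<Rightarrow> real"
  assumes Q: "\<And>u. 0 < u \<Longrightarrow> u < 1 \<Longrightarrow> Q u \<in> S \<and> F (Q u) = u \<and> isCont Q u"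
    and G: "\<And>x. (G has_real_derivative F x) (at x)"
    and K: "\<And>x. (K has_real_derivative - (1 - F x)\<^sup>2) (at x)"
    and pos: "\<And>x. x \<in> S \<Longrightarrow> 0 < G x"
    and eq: "\<And>x. x \<in> S \<Longrightarrow> F x * K x = 3 * (1 - F x)\<^sup>2 * G x"
  shows "\<exists>c>0. \<forall>u\<in>{0<..<1}. (Q has_real_derivative
           c * ((1 + u) / (u powr (5/4) * (1 - u) powr (5/2)))) (at u)"
proof -
  define g where "g u = G (Q u)" for u
  have g_pos: "0 < g u" if "0 < u" "u < 1" for u using Q[OF that] pos by (simp add: g_def)
  have dQ: "(Q has_real_derivative 3/4 * (1 + u) * g u / ((1 - u) * u\<^sup>2)) (at u)"
    if u: "0 < u" "u < 1" for u
  proof -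
    have K_eq: "K (Q v) / G (Q v) = 3 * (1 - v)\<^sup>2 / v" if "0 < v" "v < 1" for v
      using Q[OF that] pos[of "Q v"] eq[of "Q v"] that by (simp add: field_simps)
    have gne: "G (Q u) \<noteq> 0" using g_pos[OF u] by (simp add: g_def)
    have KQ: "K (Q u) = 3 * (1 - u)\<^sup>2 * g u / u"
      using Q[OF u] eq[of "Q u"] u by (simp add: field_simps g_def)
    have "((\<lambda>x. K x / G x) has_real_derivative
            (- (1 - u)\<^sup>2 * G (Q u) - K (Q u) * u) / (G (Q u) * G (Q u))) (at (Q u))"
      using DERIV_divide[OF K G gne] Q[OF u] by simp
    \<comment> \<open>By \<open>KQ\<close> the product \<open>K (Q u) * u\<close> equals
      \<open>3 * (1 - u)^2 * g u\<close>, so the numerator collapses to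
      \<open>- 4 * (1 - u)^2 * g u\<close>. The quotient is nonzero, as
      \<open>DERIV_factor_through\<close> requires.\<close>
    also have "(- (1 - u)\<^sup>2 * G (Q u) - K (Q u) * u) / (G (Q u) * G (Q u)) = - 4 * (1 - u)\<^sup>2 / g u"
      using u g_pos[OF u] unfolding KQ g_def[symmetric] by (simp add: divide_simps)
    finally have R: "((\<lambda>x. K x / G x) has_real_derivative - 4 * (1 - u)\<^sup>2 / g u) (at (Q u))" .
    have p: "((\<lambda>v. 3 * (1 - v)\<^sup>2 / v) has_real_derivative - 3 * (1 - u) * (1 + u) / u\<^sup>2) (at u)"
      using u by (auto intro!: derivative_eq_intros simp: divide_simps power2_eq_square) (simp add: algebra_simps)
    have "\<forall>\<^sub>F v in at u. v \<in> {0<..<1}"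
      using u by (intro eventually_at_in_open') auto
    then have ev: "\<forall>\<^sub>F v in at u. K (Q v) / G (Q v) = 3 * (1 - v)\<^sup>2 / v"
      by eventually_elim (simp add: K_eq)
    have "(Q has_real_derivative (- 3 * (1 - u) * (1 + u) / u\<^sup>2) / (- 4 * (1 - u)\<^sup>2 / g u)) (at u)"
      by (rule DERIV_factor_through[OF _ R _ p ev]) (use Q[OF u] u g_pos[OF u] K_eq[OF u] in auto)
    also have "(- 3 * (1 - u) * (1 + u) / u\<^sup>2) / (- 4 * (1 - u)\<^sup>2 / g u) = 3/4 * (1 + u) * g u / ((1 - u) * u\<^sup>2)"
      using u g_pos[OF u] by (simp add: divide_simps power2_eq_square) (simp add: algebra_simps)
    finally show ?thesis .
  qed
  have dg: "(g has_real_derivative (3/4 * (1 + u) / ((1 - u) * u)) * g u) (at u)"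
    if u: "0 < u" "u < 1" for u
  proof -
    have "(g has_real_derivative u * (3/4 * (1 + u) * g u / ((1 - u) * u\<^sup>2))) (at u)"
      unfolding g_def using DERIV_chain2[OF G dQ[OF u]] Q[OF u] by (simp add: g_def)
    also have "u * (3/4 * (1 + u) * g u / ((1 - u) * u\<^sup>2)) = (3/4 * (1 + u) / ((1 - u) * u)) * g u"
      using u by (simp add: power2_eq_square divide_simps)
    finally show ?thesis .
  qed
  \<comment> \<open>The integrating factor comes from
    \<open>(1 + u) / ((1 - u) * u) = 1 / u + 2 / (1 - u)\<close>: the logarithmic derivative of
    \<open>g\<close> is \<open>(3/4) / u + (3/2) / (1 - u)\<close>, which the two powers
    cancel.\<close>
  have "((\<lambda>u. g u * (u powr (-3/4) * (1 - u) powr (3/2))) has_real_derivative 0) (at u within {0<..<1})"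
    if "u \<in> {0<..<1}" for u
  proof -
    have u: "0 < u" "u < 1" using that by auto
    have pu: "u powr (-3/4 - 1) = u powr (-3/4) / u" "(1 - u) powr (3/2 - 1) = (1 - u) powr (3/2) / (1 - u)"
      using u by (simp_all only: powr_diff powr_one)
    have "((\<lambda>u. g u * (u powr (-3/4) * (1 - u) powr (3/2))) has_real_derivative
       (3/4 * (1 + u) / ((1 - u) * u)) * g u * (u powr (-3/4) * (1 - u) powr (3/2)) +
       ((-3/4 * u powr (-3/4 - 1)) * (1 - u) powr (3/2) + (- (3/2) * (1 - u) powr (3/2 - 1)) * u powr (-3/4)) * g u) (at u)"
      using u by (intro DERIV_mult dg) (auto intro!: derivative_eq_intros)
    also have "(3/4 * (1 + u) / ((1 - u) * u)) * g u * (u powr (-3/4) * (1 - u) powr (3/2)) +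
       ((-3/4 * u powr (-3/4 - 1)) * (1 - u) powr (3/2) + (- (3/2) * (1 - u) powr (3/2 - 1)) * u powr (-3/4)) * g u = 0"
      unfolding pu using u by (simp add: divide_simps) (simp add: algebra_simps)
    finally show ?thesis by (rule has_field_derivative_at_within)
  qed
  then have "\<exists>C. \<forall>u\<in>{0<..<1}. g u * (u powr (-3/4) * (1 - u) powr (3/2)) = C"
    by (intro has_field_derivative_zero_constant) auto
  then obtain C where C: "\<And>u. u \<in> {0<..<1} \<Longrightarrow> g u * (u powr (-3/4) * (1 - u) powr (3/2)) = C"
    by blast
  \<comment> \<open>Any point of (0,1) would do to determine the sign of the constant.\<close>
  have "g (1/2) * ((1/2) powr (-3/4) * (1 - 1/2) powr (3/2)) > 0"
    using g_pos[of "1/2"] by (intro mult_pos_pos) auto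
  with C[of "1/2"] have "C > 0" by simp
  \<comment> \<open>Inserting \<open>g = C * u powr (3/4) * (1 - u) powr (-3/2)\<close> shifts the
    exponents by the factors \<open>u^2\<close> and \<open>1 - u\<close> in the denominator, to
    \<open>-5/4\<close> and \<open>-5/2\<close>.\<close>
  have "3/4 * (1 + u) * g u / ((1 - u) * u\<^sup>2) = (3/4 * C) * ((1 + u) / (u powr (5/4) * (1 - u) powr (5/2)))"
    if "u \<in> {0<..<1}" for u
  proof -
    have u: "0 < u" "u < 1" using that by auto
    have 1: "u\<^sup>2 * u powr (-3/4) = u powr (5/4)" "(1 - u) powr (5/2) = (1 - u) powr (3/2) * (1 - u)"
      using u by (simp_all flip: powr_numeral add: powr_add[symmetric]) (simp add: powr_mult_base mult.commute)
    show ?thesis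
      unfolding C[OF that, symmetric] 1(1)[symmetric] 1(2) using u by (simp add: divide_simps)
  qed
  then show ?thesis using dQ \<open>C > 0\<close> by (intro exI[of _ "3/4 * C"]) auto
qed

section \<open>Expectations and independence\<close>

text \<open>For \<open>y \<le> z\<close> the increment of \<open>max 0 (y - w)\<close> between
  \<open>y\<close> and \<open>z\<close> lies between \<open>z - y\<close> times the indicators of
  \<open>w \<le> y\<close> and of \<open>w \<le> z\<close>. The difference quotient of the
  expectation is therefore squeezed between two values of the distribution function, and continuity
  at \<open>y\<close> concludes.\<close>

lemma (in prob_space) DERIV_expectation_pos_part:
  fixes W :: "'a \<Rightarrow> real"
  assumes [measurable]: "random_variable borel W"
    and int: "\<And>y. integrable M (\<lambda>\<omega>. max 0 (y - W \<omega>))"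
    and cont: "isCont (\<lambda>y. prob {\<omega> \<in> space M. W \<omega> \<le> y}) y"
  shows "((\<lambda>y. expectation (\<lambda>\<omega>. max 0 (y - W \<omega>))) has_real_derivative
          prob {\<omega> \<in> space M. W \<omega> \<le> y}) (at y)"
proof -
  define G where "G y = expectation (\<lambda>\<omega>. max 0 (y - W \<omega>))" for y
  define H where "H y = prob {\<omega> \<in> space M. W \<omega> \<le> y}" for y
  have H: "H y = expectation (indicator {\<omega> \<in> space M. W \<omega> \<le> y})" for y
    by (simp add: H_def)
  have intH: "integrable M (\<lambda>\<omega>. (z - y) * indicator {\<omega> \<in> space M. W \<omega> \<le> t} \<omega> :: real)" for z y t
    by (intro integrable_mult_right) (auto intro!: integrable_real_indicator simp: emeasure_eq_measure)
  have bounds: "(z - y) * H y \<le> G z - G y" "G z - G y \<le> (z - y) * H z" if "y \<le> z" for y z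
  proof -
    have Gd: "G z - G y = expectation (\<lambda>\<omega>. max 0 (z - W \<omega>) - max 0 (y - W \<omega>))"
      unfolding G_def by (intro Bochner_Integration.integral_diff[symmetric] int)
    have "(z - y) * H y = expectation (\<lambda>\<omega>. (z - y) * indicator {\<omega> \<in> space M. W \<omega> \<le> y} \<omega>)"
      by (simp add: H)
    also have "\<dots> \<le> G z - G y" unfolding Gd
      by (intro integral_mono intH Bochner_Integration.integrable_diff int)
         (use that in \<open>auto simp: indicator_def max_def\<close>)
    finally show "(z - y) * H y \<le> G z - G y" .
    have "G z - G y \<le> expectation (\<lambda>\<omega>. (z - y) * indicator {\<omega> \<in> space M. W \<omega> \<le> z} \<omega>)" unfolding Gd
      by (intro integral_mono intH Bochner_Integration.integrable_diff int)
         (use that in \<open>auto simp: indicator_def max_def\<close>)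
    also have "\<dots> = (z - y) * H z" by (simp add: H)
    finally show "G z - G y \<le> (z - y) * H z" .
  qed
  \<comment> \<open>For \<open>z < y\<close> the two ends of \<open>bounds\<close> change places,
    hence \<open>min\<close> and \<open>max\<close>.\<close>
  have sandwich: "min (H y) (H z) \<le> (G z - G y) / (z - y)" "(G z - G y) / (z - y) \<le> max (H y) (H z)"
    if "z \<noteq> y" for z
  proof -
    have "min (H y) (H z) \<le> (G z - G y) / (z - y) \<and> (G z - G y) / (z - y) \<le> max (H y) (H z)"
    proof (cases "y < z")
      case True
      with bounds[of y z] have "H y \<le> (G z - G y) / (z - y)" "(G z - G y) / (z - y) \<le> H z"
        by (simp_all add: field_simps)
      then show ?thesis by linarith
    next
      case False
      with that have "z < y" by simp
      with bounds[of z y] have "H z \<le> (G y - G z) / (y - z)" "(G y - G z) / (y - z) \<le> H y"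
        by (simp_all add: field_simps)
      moreover have "(G y - G z) / (y - z) = (G z - G y) / (z - y)"
        by (metis minus_diff_eq minus_divide_divide)
      ultimately show ?thesis by linarith
    qed
    then show "min (H y) (H z) \<le> (G z - G y) / (z - y)" "(G z - G y) / (z - y) \<le> max (H y) (H z)" by auto
  qed
  have lim: "(H \<longlongrightarrow> H y) (at y)" using cont unfolding H_def isCont_def .
  have "((\<lambda>z. (G z - G y) / (z - y)) \<longlongrightarrow> H y) (at y)"
  proof (rule tendsto_sandwich)
    show "\<forall>\<^sub>F z in at y. min (H y) (H z) \<le> (G z - G y) / (z - y)"
      "\<forall>\<^sub>F z in at y. (G z - G y) / (z - y) \<le> max (H y) (H z)"
      using sandwich by (auto simp: eventually_at_filter)
    show "((\<lambda>z. min (H y) (H z)) \<longlongrightarrow> H y) (at y)" "((\<lambda>z. max (H y) (H z)) \<longlongrightarrow> H y) (at y)"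
      using tendsto_min[OF tendsto_const[of "H y"] lim] tendsto_max[OF tendsto_const[of "H y"] lim] by simp_all
  qed
  then show ?thesis
    unfolding has_field_derivative_iff G_def H_def .
qed

text \<open>Fubini for the joint law, which independence makes a product, pulled back to
  \<open>M\<close>: the outer variable freezes \<open>U\<close> while the inner expectation averages
  over \<open>V\<close>.\<close>

lemma (in prob_space) expectation_indep_var:
  fixes g :: "'b \<times> 'b \<Rightarrow> real"
  assumes ind: "indep_var S U T V" and [measurable]: "g \<in> borel_measurable (S \<Otimes>\<^sub>M T)"
    and int: "integrable M (\<lambda>\<omega>. g (U \<omega>, V \<omega>))"
  shows "expectation (\<lambda>\<omega>. g (U \<omega>, V \<omega>)) = expectation (\<lambda>\<omega>'. expectation (\<lambda>\<omega>. g (U \<omega>', V \<omega>)))"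
    and "integrable M (\<lambda>\<omega>'. expectation (\<lambda>\<omega>. g (U \<omega>', V \<omega>)))"
proof -
  have [measurable]: "random_variable S U" "random_variable T V"
    using ind by (auto dest: indep_var_rv1 indep_var_rv2)
  interpret U: prob_space "distr M S U" by (rule prob_space_distr) simp
  interpret V: prob_space "distr M T V" by (rule prob_space_distr) simp
  interpret P: pair_prob_space "distr M S U" "distr M T V" ..
  have eq: "distr M (S \<Otimes>\<^sub>M T) (\<lambda>\<omega>. (U \<omega>, V \<omega>)) = distr M S U \<Otimes>\<^sub>M distr M T V"
    using ind by (simp add: indep_var_distribution_eq)
  have "integrable (distr M (S \<Otimes>\<^sub>M T) (\<lambda>\<omega>. (U \<omega>, V \<omega>))) g"
    by (subst integrable_distr_eq) (use int in simp_all)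
  then have g: "integrable (distr M S U \<Otimes>\<^sub>M distr M T V) g" by (simp add: eq)
  have inner: "(\<integral>y. g (U \<omega>, y) \<partial>distr M T V) = expectation (\<lambda>\<omega>'. g (U \<omega>, V \<omega>'))" if "\<omega> \<in> space M" for \<omega>
    using that by (subst integral_distr) (simp_all add: measurable_space[of U M S])
  have [measurable]: "(\<lambda>x. \<integral>y. g (x, y) \<partial>distr M T V) \<in> borel_measurable S"
    using P.integrable_fst'[OF g, THEN borel_measurable_integrable] by simp
  have "expectation (\<lambda>\<omega>. g (U \<omega>, V \<omega>)) = integral\<^sup>L (distr M (S \<Otimes>\<^sub>M T) (\<lambda>\<omega>. (U \<omega>, V \<omega>))) g"
    by (subst integral_distr) simp_all
  also have "\<dots> = (\<integral>x. (\<integral>y. g (x, y) \<partial>distr M T V) \<partial>distr M S U)"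
    using P.integral_fst'[OF g] by (simp add: eq)
  also have "\<dots> = expectation (\<lambda>\<omega>'. \<integral>y. g (U \<omega>', y) \<partial>distr M T V)"
    by (subst integral_distr) simp_all
  also have "\<dots> = expectation (\<lambda>\<omega>'. expectation (\<lambda>\<omega>. g (U \<omega>', V \<omega>)))"
    by (intro Bochner_Integration.integral_cong) (simp_all add: inner)
  finally show "expectation (\<lambda>\<omega>. g (U \<omega>, V \<omega>)) = expectation (\<lambda>\<omega>'. expectation (\<lambda>\<omega>. g (U \<omega>', V \<omega>)))" .
  have "integrable M (\<lambda>\<omega>'. \<integral>y. g (U \<omega>', y) \<partial>distr M T V)"
    using P.integrable_fst'[OF g] by (subst (asm) integrable_distr_eq) simp_all
  then show "integrable M (\<lambda>\<omega>'. expectation (\<lambda>\<omega>. g (U \<omega>', V \<omega>)))"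
    by (rule Bochner_Integration.integrable_cong[THEN iffD1, rotated -1]) (simp_all add: inner)
qed

section \<open>Order statistics of two and of four points\<close>

lemma order_stat_1_2: "order_stat 1 2 X \<omega> = min (X 1 \<omega>) (X 2 \<omega>)"
  and order_stat_2_2: "order_stat 2 2 X \<omega> = max (X 1 \<omega>) (X 2 \<omega>)"
  by (simp_all add: order_stat_def upt_rec numeral_2_eq_2 min_def max_def)

lemma order_stat_4:
  "order_stat i 4 X \<omega> = sort [X 1 \<omega>, X 2 \<omega>, X 3 \<omega>, X 4 \<omega>] ! (i - 1)"
  by (simp add: order_stat_def upt_rec eval_nat_numeral)

text \<open>Negation reverses the order, exchanging the second and third smallest; list positions
  start at 0.\<close>

lemma sort_4_uminus:
  fixes x1 x2 x3 x4 :: real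
  shows "sort [- x1, - x2, - x3, - x4] ! 1 = - (sort [x1, x2, x3, x4] ! 2)"
  by (simp add: numeral_2_eq_2)

text \<open>Order each of the two pairs. The second smallest point overall is either the larger of
  the pair minima or the smaller of the pair maxima, whichever is less. As an expression in
  \<open>min\<close> and \<open>max\<close> it is visibly measurable in the sample.\<close>

lemma sort_4_second:
  fixes x1 x2 x3 x4 :: real
  shows "sort [x1, x2, x3, x4] ! 1 = min (max (min x1 x2) (min x3 x4)) (min (max x1 x2) (max x3 x4))"
  by (cases "x1 \<le> x2"; cases "x1 \<le> x3"; cases "x1 \<le> x4"; cases "x2 \<le> x3"; cases "x2 \<le> x4"; cases "x3 \<le> x4")
     (simp_all add: max_def min_def)

text \<open>
  In the orderings where \<open>y\<close> is itself \<open>min x1 x2\<close> the left-hand side vanishes, so they contribute no term.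
\<close>

lemma second_of_4_decomposition:
  fixes x1 x2 x3 x4 :: real and \<phi> :: "real \<Rightarrow> real"
  defines "A \<equiv> \<lambda>i j k l. \<phi> j * (max 0 (j - i) * (if j < k then 1 else 0) * (if j < l then 1 else 0))"
    and "B \<equiv> \<lambda>i j k l. \<phi> j * ((if i < j then 1 else 0) * max 0 (min k l - j))"
    and "y \<equiv> sort [x1, x2, x3, x4] ! 1"
  assumes "distinct [x1, x2, x3, x4]"
  shows "(min x1 x2 - y) * \<phi> y = B x4 x3 x1 x2 + B x3 x4 x1 x2
    - (A x2 x1 x3 x4 + A x1 x2 x3 x4 + A x1 x3 x2 x4 + A x2 x3 x1 x4 + A x1 x4 x2 x3 + A x2 x4 x1 x3)"
  using assms(4) unfolding assms(1-3)
  by (cases "x1 < x2"; cases "x1 < x3"; cases "x1 < x4"; cases "x2 < x3"; cases "x2 < x4"; cases "x3 < x4")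
     (simp_all add: max_def min_def, simp_all add: algebra_simps)

section \<open>Samples of size four\<close>

text \<open>Continuity of \<open>F\<close> rules out atoms and ties. This setting is preserved when
  \<open>X\<close> is replaced by its negative, which lets the statement on maxima be read off from
  the one on minima.\<close>

locale iid_sample = prob_space M for M :: "'a measure" +
  fixes X :: "nat \<Rightarrow> 'a \<Rightarrow> real" and F :: "real \<Rightarrow> real"
  assumes indep: "indep_vars (\<lambda>_. borel) X {1..4}"
    and cdf_X: "i \<in> {1..4} \<Longrightarrow> cdf (distr M borel (X i)) = F"
    and cont: "continuous_on UNIV F"
begin

lemma rv: "i \<in> {1..4} \<Longrightarrow> random_variable borel (X i)"
  using indep unfolding indep_vars_def by auto

lemma rv_X [measurable]: "random_variable borel (X 1)" "random_variable borel (X (Suc 0))"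
  "random_variable borel (X 2)" "random_variable borel (X 3)" "random_variable borel (X 4)"
  using rv[of 1] rv[of 2] rv[of 3] rv[of 4] by simp_all

lemma real_distribution_X: "i \<in> {1..4} \<Longrightarrow> real_distribution (distr M borel (X i))"
  by (intro real_distribution_distr rv)

lemma distr_X: "i \<in> {1..4} \<Longrightarrow> distr M borel (X i) = distr M borel (X 1)"
  by (intro cdf_unique real_distribution_X) (auto simp: cdf_X)

lemma expectation_X:
  assumes "i \<in> {1..4}" "h \<in> borel_measurable borel"
  shows "expectation (\<lambda>\<omega>. h (X i \<omega>) :: real) = expectation (\<lambda>\<omega>. h (X 1 \<omega>))"
  using integral_distr[OF rv[of i] assms(2)] integral_distr[OF rv[of 1] assms(2)] assms(1) distr_X[of i]
  by simp

lemma integrable_X: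
  assumes "i \<in> {1..4}" "h \<in> borel_measurable borel"
  shows "integrable M (\<lambda>\<omega>. h (X i \<omega>) :: real) \<longleftrightarrow> integrable M (\<lambda>\<omega>. h (X 1 \<omega>))"
  using integrable_distr_eq[OF rv[of i] assms(2)] integrable_distr_eq[OF rv[of 1] assms(2)] assms(1) distr_X[of i]
  by simp

lemma isCont_F: "isCont F x"
  using cont by (simp add: continuous_on_eq_continuous_at)

lemma F_lim: "(F \<longlongrightarrow> 0) at_bot" "(F \<longlongrightarrow> 1) at_top"
proof -
  interpret D: real_distribution "distr M borel (X 1)" by (rule real_distribution_X) simp
  show "(F \<longlongrightarrow> 0) at_bot" "(F \<longlongrightarrow> 1) at_top"
    using D.cdf_lim_at_bot D.cdf_lim_at_top_prob cdf_X[of 1] by simp_all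
qed

lemma prob_X_le: "i \<in> {1..4} \<Longrightarrow> prob {\<omega> \<in> space M. X i \<omega> \<le> x} = F x"
  using cdf_X[of i, symmetric] by (simp add: cdf_def measure_distr rv vimage_def Int_def conj_commute)

lemma prob_X_eq:
  assumes i: "i \<in> {1..4}" shows "prob {\<omega> \<in> space M. X i \<omega> = x} = 0"
proof -
  interpret D: real_distribution "distr M borel (X i)" by (rule real_distribution_X[OF i])
  have "measure (distr M borel (X i)) {x} = 0"
    using D.isCont_cdf[of x] isCont_F cdf_X[OF i] by simp
  then show ?thesis using i by (simp add: measure_distr rv vimage_def Int_def conj_commute)
qed

lemma prob_X_less:
  assumes i: "i \<in> {1..4}" shows "prob {\<omega> \<in> space M. X i \<omega> < x} = F x"
proof -
  note [measurable] = rv[OF i]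
  have "prob {\<omega> \<in> space M. X i \<omega> \<le> x} = prob ({\<omega> \<in> space M. X i \<omega> < x} \<union> {\<omega> \<in> space M. X i \<omega> = x})"
    by (intro arg_cong[where f=prob]) auto
  also have "\<dots> = prob {\<omega> \<in> space M. X i \<omega> < x} + prob {\<omega> \<in> space M. X i \<omega> = x}"
    by (intro finite_measure_Union) auto
  finally show ?thesis using prob_X_le[OF i] prob_X_eq[OF i] by simp
qed

lemma prob_X_greater:
  assumes i: "i \<in> {1..4}" shows "prob {\<omega> \<in> space M. x < X i \<omega>} = 1 - F x"
proof -
  note [measurable] = rv[OF i]
  have "{\<omega> \<in> space M. x < X i \<omega>} = space M - {\<omega> \<in> space M. X i \<omega> \<le> x}" by auto
  then show ?thesis using prob_X_le[OF i] by (simp add: prob_compl)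
qed

lemma prob_X_ge:
  assumes i: "i \<in> {1..4}" shows "prob {\<omega> \<in> space M. x \<le> X i \<omega>} = 1 - F x"
proof -
  note [measurable] = rv[OF i]
  have "{\<omega> \<in> space M. x \<le> X i \<omega>} = space M - {\<omega> \<in> space M. X i \<omega> < x}" by auto
  then show ?thesis using prob_X_less[OF i] by (simp add: prob_compl)
qed

lemma expectation_less: "i \<in> {1..4} \<Longrightarrow> expectation (\<lambda>\<omega>. if X i \<omega> < x then 1 else 0 :: real) = F x"
  and expectation_greater: "i \<in> {1..4} \<Longrightarrow> expectation (\<lambda>\<omega>. if x < X i \<omega> then 1 else 0 :: real) = 1 - F x"
  and integrable_less: "i \<in> {1..4} \<Longrightarrow> integrable M (\<lambda>\<omega>. if X i \<omega> < x then 1 else 0 :: real)"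
  and integrable_greater: "i \<in> {1..4} \<Longrightarrow> integrable M (\<lambda>\<omega>. if x < X i \<omega> then 1 else 0 :: real)"
proof -
  assume i: "i \<in> {1..4}"
  note [measurable] = rv[OF i]
  have "expectation (\<lambda>\<omega>. if X i \<omega> < x then 1 else 0 :: real) = expectation (indicator {\<omega> \<in> space M. X i \<omega> < x})"
    by (intro Bochner_Integration.integral_cong) (auto simp: indicator_def)
  also have "\<dots> = prob {\<omega> \<in> space M. X i \<omega> < x}" by simp
  finally show "expectation (\<lambda>\<omega>. if X i \<omega> < x then 1 else 0 :: real) = F x" by (simp only: prob_X_less[OF i])
  have "expectation (\<lambda>\<omega>. if x < X i \<omega> then 1 else 0 :: real) = expectation (indicator {\<omega> \<in> space M. x < X i \<omega>})"
    by (intro Bochner_Integration.integral_cong) (auto simp: indicator_def)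
  also have "\<dots> = prob {\<omega> \<in> space M. x < X i \<omega>}" by simp
  finally show "expectation (\<lambda>\<omega>. if x < X i \<omega> then 1 else 0 :: real) = 1 - F x" by (simp only: prob_X_greater[OF i])
  show "integrable M (\<lambda>\<omega>. if X i \<omega> < x then 1 else 0 :: real)"
    "integrable M (\<lambda>\<omega>. if x < X i \<omega> then 1 else 0 :: real)"
    by (intro integrable_const_bound[where B=1]; simp)+
qed

text \<open>Separates the coordinate that will be frozen from those averaged over. The single
  coordinate is wrapped as a function on \<open>{j}\<close> because \<open>indep_var\<close> needs
  both variables to have values in the same type.\<close>

lemma indep_var_X_restrict:
  assumes "j \<in> {1..4}" "J \<subseteq> {1..4}" "j \<notin> J"
  shows "indep_var (PiM {j} (\<lambda>_. borel)) (\<lambda>\<omega>. \<lambda>i\<in>{j}. X i \<omega>) (PiM J (\<lambda>_. borel)) (\<lambda>\<omega>. \<lambda>i\<in>J. X i \<omega>)"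
  using assms by (intro indep_var_restrict[OF indep]) auto

text \<open>With \<open>X i\<close> frozen at a value, \<open>X j\<close> hits that value with
  probability 0 because its law has no atoms.\<close>

lemma AE_X_neq:
  assumes ij: "i \<in> {1..4}" "j \<in> {1..4}" "i \<noteq> j"
  shows "AE \<omega> in M. X i \<omega> \<noteq> X j \<omega>"
proof -
  note [measurable] = rv[OF ij(1)] rv[OF ij(2)]
  define g :: "(nat \<Rightarrow> real) \<times> (nat \<Rightarrow> real) \<Rightarrow> real" where "g = (\<lambda>(u, v). if u i = v j then 1 else 0)"
  have g: "g \<in> borel_measurable (PiM {i} (\<lambda>_. borel) \<Otimes>\<^sub>M PiM {j} (\<lambda>_. borel))"
    unfolding g_def by measurable
  have ind: "expectation (\<lambda>\<omega>. if X j \<omega> = x then 1 else 0 :: real) = 0" for x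
  proof -
    have "expectation (\<lambda>\<omega>. if X j \<omega> = x then 1 else 0 :: real) = expectation (indicator {\<omega> \<in> space M. X j \<omega> = x})"
      by (intro Bochner_Integration.integral_cong) (auto simp: indicator_def)
    also have "\<dots> = prob {\<omega> \<in> space M. X j \<omega> = x}" by simp
    finally show ?thesis by (simp only: prob_X_eq[OF ij(2)])
  qed
  have int: "integrable M (\<lambda>\<omega>. if X i \<omega> = X j \<omega> then 1 else 0 :: real)"
    by (intro integrable_const_bound[where B=1]) auto
  have "expectation (\<lambda>\<omega>. if X i \<omega> = X j \<omega> then 1 else 0 :: real) = 0"
    using expectation_indep_var(1)[OF indep_var_X_restrict[of i "{j}"] g] ij int ind
    by (simp add: g_def eq_commute[of "X i _"])
  then have "AE \<omega> in M. (if X i \<omega> = X j \<omega> then 1 else 0 :: real) = 0"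
    by (subst (asm) integral_nonneg_eq_0_iff_AE[OF int]) auto
  then show ?thesis by eventually_elim (auto split: if_splits)
qed

lemma AE_X_distinct: "AE \<omega> in M. distinct [X 1 \<omega>, X 2 \<omega>, X 3 \<omega>, X 4 \<omega>]"
proof -
  have "AE \<omega> in M. X 1 \<omega> \<noteq> X 2 \<omega> \<and> X 1 \<omega> \<noteq> X 3 \<omega> \<and> X 1 \<omega> \<noteq> X 4 \<omega> \<and>
      X 2 \<omega> \<noteq> X 3 \<omega> \<and> X 2 \<omega> \<noteq> X 4 \<omega> \<and> X 3 \<omega> \<noteq> X 4 \<omega>"
    by (intro AE_conjI AE_X_neq) auto
  then show ?thesis by eventually_elim auto
qed

section \<open>The functions \<open>G\<close> and \<open>K\<close> and the conditional contributions
  they describe\<close>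

definition G :: "real \<Rightarrow> real" where "G y = expectation (\<lambda>\<omega>. max 0 (y - X 1 \<omega>))"

definition K :: "real \<Rightarrow> real" where "K y = expectation (\<lambda>\<omega>. max 0 (min (X 1 \<omega>) (X 2 \<omega>) - y))"

context
  assumes int_min: "integrable M (\<lambda>\<omega>. min (X 1 \<omega>) (X 2 \<omega>))"
begin

lemma integrable_max_min: "integrable M (\<lambda>\<omega>. max 0 (min (X 1 \<omega>) (X 2 \<omega>) - y))"
  "integrable M (\<lambda>\<omega>. max 0 (y - min (X 1 \<omega>) (X 2 \<omega>)))"
  using int_min by (auto intro!: integrable_max)

text \<open>Integrability of the minimum controls the lower tail of a single variable:
  \<open>min (X 1 \<omega>) (X 2 \<omega>)\<close> is at most \<open>X 1 \<omega>\<close>, so the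
  positive part of \<open>y - X 1 \<omega>\<close> is dominated. Equality of laws carries this to
  the other indices.\<close>

lemma integrable_pos_part:
  assumes i: "i \<in> {1..4}" shows "integrable M (\<lambda>\<omega>. max 0 (y - X i \<omega>))"
proof -
  have "integrable M (\<lambda>\<omega>. max 0 (y - X 1 \<omega>))"
    by (rule Bochner_Integration.integrable_bound[OF integrable_max_min(2)[of y]]) auto
  then show ?thesis using integrable_X[OF i, of "\<lambda>x. max 0 (y - x)"] by simp
qed

lemma G_eq: "i \<in> {1..4} \<Longrightarrow> expectation (\<lambda>\<omega>. max 0 (y - X i \<omega>)) = G y"
  unfolding G_def by (rule expectation_X) simp_all

lemma DERIV_G: "(G has_real_derivative F y) (at y)"
  unfolding G_def using DERIV_expectation_pos_part[of "X 1" y] integrable_pos_part[of 1]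
  by (simp add: prob_X_le isCont_F)

text \<open>If the expectation of the nonnegative \<open>max 0 (y - X 1 \<omega>)\<close> vanished,
  \<open>X 1\<close> would almost surely be at least \<open>y\<close>; without atoms this means
  \<open>F y = 0\<close>.\<close>

lemma G_pos: assumes "0 < F y" shows "0 < G y"
proof (rule ccontr)
  assume "\<not> 0 < G y"
  moreover have "0 \<le> G y" unfolding G_def by (intro integral_nonneg_AE) auto
  ultimately have "AE \<omega> in M. max 0 (y - X 1 \<omega>) = 0"
    unfolding G_def using integral_nonneg_eq_0_iff_AE[OF integrable_pos_part[of 1 y]] by (simp del: One_nat_def)
  then have "AE \<omega> in M. \<not> X 1 \<omega> < y" by eventually_elim auto
  then have "prob {\<omega> \<in> space M. X 1 \<omega> < y} = 0"
    by (subst prob_eq_0) auto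
  with assms show False by (simp add: prob_X_less)
qed

text \<open>\<open>K y\<close> is the expected positive part of \<open>z - W\<close> for
  \<open>W\<close> the negated minimum and \<open>z = - y\<close>. By independence the distribution
  function of \<open>W\<close> at \<open>z\<close> is \<open>(1 - F (- z))^2\<close>, and the inner
  derivative \<open>-1\<close> gives the sign.\<close>

lemma DERIV_K: "(K has_real_derivative - (1 - F y)\<^sup>2) (at y)"
proof -
  have P: "prob {\<omega> \<in> space M. - min (X 1 \<omega>) (X 2 \<omega>) \<le> z} = (1 - F (- z))\<^sup>2" for z
  proof -
    have "{\<omega> \<in> space M. - min (X 1 \<omega>) (X 2 \<omega>) \<le> z} = (\<Inter>i\<in>{1,2}. X i -` {- z..} \<inter> space M)" by auto
    also have "prob \<dots> = (\<Prod>i\<in>{1,2}. prob (X i -` {- z..} \<inter> space M))"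
      by (rule indep_varsD[OF indep]) auto
    also have "\<dots> = (1 - F (- z))\<^sup>2"
      using prob_X_ge[of 1 "- z"] prob_X_ge[of 2 "- z"]
      by (simp add: power2_eq_square vimage_def Int_def conj_commute)
    finally show ?thesis .
  qed
  have "isCont (\<lambda>z. (1 - F (- z))\<^sup>2) (- y)"
    by (intro continuous_intros isCont_o2[OF _ isCont_F])
  then have "((\<lambda>z. expectation (\<lambda>\<omega>. max 0 (z - - min (X 1 \<omega>) (X 2 \<omega>)))) has_real_derivative (1 - F y)\<^sup>2) (at (- y))"
    using DERIV_expectation_pos_part[of "\<lambda>\<omega>. - min (X 1 \<omega>) (X 2 \<omega>)" "- y"] integrable_max_min(1)[of "- _"]
    unfolding P by (simp add: add.commute)
  from DERIV_chain2[OF this DERIV_minus[OF DERIV_ident]] show ?thesis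
    by (simp add: K_def[abs_def] add.commute)
qed

text \<open>Here \<open>X j\<close> is second smallest, \<open>X i\<close> lies below it and the
  other two above. Given \<open>X j = x\<close> the three factors are independent with expectations
  \<open>G x\<close>, \<open>1 - F x\<close> and \<open>1 - F x\<close>. The result is the same for
  every choice of indices, since finally \<open>X j\<close> may be replaced by
  \<open>X 1\<close>.\<close>

lemma expectation_below:
  fixes \<phi> :: "real \<Rightarrow> real"
  assumes ijkl: "i \<in> {1..4}" "j \<in> {1..4}" "k \<in> {1..4}" "l \<in> {1..4}" "distinct [i, j, k, l]"
    and [measurable]: "\<phi> \<in> borel_measurable borel"
  defines "A \<equiv> \<lambda>\<omega>. \<phi> (X j \<omega>) * (max 0 (X j \<omega> - X i \<omega>) *
      (if X j \<omega> < X k \<omega> then 1 else 0) * (if X j \<omega> < X l \<omega> then 1 else 0))"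
  assumes int: "integrable M A"
  shows "expectation A = expectation (\<lambda>\<omega>. \<phi> (X 1 \<omega>) * (G (X 1 \<omega>) * (1 - F (X 1 \<omega>))\<^sup>2))"
    and "integrable M (\<lambda>\<omega>. \<phi> (X 1 \<omega>) * (G (X 1 \<omega>) * (1 - F (X 1 \<omega>))\<^sup>2))"
proof -
  define g :: "(nat \<Rightarrow> real) \<times> (nat \<Rightarrow> real) \<Rightarrow> real" where
    "g = (\<lambda>(u, v). \<phi> (u j) * (max 0 (u j - v i) * (if u j < v k then 1 else 0) * (if u j < v l then 1 else 0)))"
  have g: "g \<in> borel_measurable (PiM {j} (\<lambda>_. borel) \<Otimes>\<^sub>M PiM {i, k, l} (\<lambda>_. borel))"
    unfolding g_def by measurable
  have inner: "expectation (\<lambda>\<omega>. max 0 (x - X i \<omega>) * (if x < X k \<omega> then 1 else 0) * (if x < X l \<omega> then 1 else 0)) =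
      G x * (1 - F x)\<^sup>2" for x
  proof -
    \<comment> \<open>Casts the three factors as one indexed family, the form in which the product
      rule for expectations applies.\<close>
    define h where "h m t = (if m = i then max 0 (x - t) else if x < t then 1 else 0 :: real)" for m t
    have h: "indep_vars (\<lambda>_. borel) (\<lambda>m \<omega>. h m (X m \<omega>)) {i, k, l}"
      by (rule indep_vars_compose2[OF indep_vars_subset[OF indep]]) (use ijkl in \<open>auto simp: h_def\<close>)
    have "expectation (\<lambda>\<omega>. \<Prod>m\<in>{i, k, l}. h m (X m \<omega>)) = (\<Prod>m\<in>{i, k, l}. expectation (\<lambda>\<omega>. h m (X m \<omega>)))"
      by (rule indep_vars_lebesgue_integral[OF _ h])
         (use ijkl in \<open>auto simp: h_def integrable_pos_part integrable_greater\<close>)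
    then show ?thesis
      using ijkl by (simp add: h_def G_eq expectation_greater power2_eq_square mult.assoc)
  qed
  note dec = expectation_indep_var[OF indep_var_X_restrict[of j "{i, k, l}"] g]
  have intg: "integrable M (\<lambda>\<omega>. g (\<lambda>m\<in>{j}. X m \<omega>, \<lambda>m\<in>{i, k, l}. X m \<omega>))"
    using int by (simp add: g_def A_def)
  have m: "(\<lambda>x. \<phi> x * (G x * (1 - F x)\<^sup>2)) \<in> borel_measurable borel"
  proof -
    have [measurable]: "F \<in> borel_measurable borel" "G \<in> borel_measurable borel"
      using cont DERIV_continuous_on[of UNIV G F] DERIV_G by (auto intro: borel_measurable_continuous_onI)
    show ?thesis by measurable
  qed
  have "expectation A = expectation (\<lambda>\<omega>. \<phi> (X j \<omega>) * (G (X j \<omega>) * (1 - F (X j \<omega>))\<^sup>2))"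
    using dec(1)[OF _ _ _ intg] ijkl by (simp add: g_def A_def inner)
  then show "expectation A = expectation (\<lambda>\<omega>. \<phi> (X 1 \<omega>) * (G (X 1 \<omega>) * (1 - F (X 1 \<omega>))\<^sup>2))"
    using expectation_X[OF ijkl(2) m] by simp
  have "integrable M (\<lambda>\<omega>. \<phi> (X j \<omega>) * (G (X j \<omega>) * (1 - F (X j \<omega>))\<^sup>2))"
    using dec(2)[OF _ _ _ intg] ijkl by (simp add: g_def A_def inner)
  then show "integrable M (\<lambda>\<omega>. \<phi> (X 1 \<omega>) * (G (X 1 \<omega>) * (1 - F (X 1 \<omega>))\<^sup>2))"
    using integrable_X[OF ijkl(2) m] by simp
qed

text \<open>Now \<open>X j\<close> is second smallest with \<open>X i\<close> below it and both
  \<open>X 1\<close> and \<open>X 2\<close> above. Given \<open>X j = x\<close>, the indicator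
  depends on \<open>X i\<close> alone and the positive part on the pair \<open>X 1\<close>,
  \<open>X 2\<close>, so the expectation factors as \<open>F x * K x\<close>.\<close>

lemma expectation_above:
  fixes \<phi> :: "real \<Rightarrow> real"
  assumes ij: "i \<in> {1..4}" "j \<in> {1..4}" "distinct [i, j, 1, 2]"
    and [measurable]: "\<phi> \<in> borel_measurable borel"
  defines "B \<equiv> \<lambda>\<omega>. \<phi> (X j \<omega>) * ((if X i \<omega> < X j \<omega> then 1 else 0) * max 0 (min (X 1 \<omega>) (X 2 \<omega>) - X j \<omega>))"
  assumes int: "integrable M B"
  shows "expectation B = expectation (\<lambda>\<omega>. \<phi> (X 1 \<omega>) * (F (X 1 \<omega>) * K (X 1 \<omega>)))"
    and "integrable M (\<lambda>\<omega>. \<phi> (X 1 \<omega>) * (F (X 1 \<omega>) * K (X 1 \<omega>)))"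
proof -
  define g :: "(nat \<Rightarrow> real) \<times> (nat \<Rightarrow> real) \<Rightarrow> real" where
    "g = (\<lambda>(u, v). \<phi> (u j) * ((if v i < u j then 1 else 0) * max 0 (min (v 1) (v 2) - u j)))"
  have g: "g \<in> borel_measurable (PiM {j} (\<lambda>_. borel) \<Otimes>\<^sub>M PiM {i, 1, 2} (\<lambda>_. borel))"
    unfolding g_def by measurable
  have inner: "expectation (\<lambda>\<omega>. (if X i \<omega> < x then 1 else 0) * max 0 (min (X 1 \<omega>) (X 2 \<omega>) - x)) =
      F x * K x" for x
  proof -
    have m: "(\<lambda>u :: nat \<Rightarrow> real. if u i < x then 1 else 0 :: real) \<in> borel_measurable (PiM {i} (\<lambda>_. borel))"
      "(\<lambda>v :: nat \<Rightarrow> real. max 0 (min (v 1) (v 2) - x)) \<in> borel_measurable (PiM {1, 2} (\<lambda>_. borel))"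
      by measurable
    have "indep_var borel (\<lambda>\<omega>. if X i \<omega> < x then 1 else 0 :: real) borel (\<lambda>\<omega>. max 0 (min (X 1 \<omega>) (X 2 \<omega>) - x))"
      using indep_var_compose[OF indep_var_X_restrict[of i "{1, 2}"] m] ij by (simp add: comp_def)
    then show ?thesis
      using ij by (subst indep_var_lebesgue_integral)
         (simp_all add: integrable_less integrable_max_min expectation_less K_def del: One_nat_def)
  qed
  note dec = expectation_indep_var[OF indep_var_X_restrict[of j "{i, 1, 2}"] g]
  have intg: "integrable M (\<lambda>\<omega>. g (\<lambda>m\<in>{j}. X m \<omega>, \<lambda>m\<in>{i, 1, 2}. X m \<omega>))"
    using int by (simp add: g_def B_def)
  have m: "(\<lambda>x. \<phi> x * (F x * K x)) \<in> borel_measurable borel"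
  proof -
    have [measurable]: "F \<in> borel_measurable borel" "K \<in> borel_measurable borel"
      using cont DERIV_continuous_on[of UNIV K "\<lambda>x. - (1 - F x)\<^sup>2"] DERIV_K by (auto intro: borel_measurable_continuous_onI)
    show ?thesis by measurable
  qed
  have "expectation B = expectation (\<lambda>\<omega>. \<phi> (X j \<omega>) * (F (X j \<omega>) * K (X j \<omega>)))"
    using dec(1)[OF _ _ _ intg] ij by (simp add: g_def B_def inner del: One_nat_def)
  then show "expectation B = expectation (\<lambda>\<omega>. \<phi> (X 1 \<omega>) * (F (X 1 \<omega>) * K (X 1 \<omega>)))"
    using expectation_X[OF ij(2) m] by simp
  have "integrable M (\<lambda>\<omega>. \<phi> (X j \<omega>) * (F (X j \<omega>) * K (X j \<omega>)))"
    using dec(2)[OF _ _ _ intg] ij by (simp add: g_def B_def inner del: One_nat_def)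
  then show "integrable M (\<lambda>\<omega>. \<phi> (X 1 \<omega>) * (F (X 1 \<omega>) * K (X 1 \<omega>)))"
    using integrable_X[OF ij(2) m] by simp
qed

section \<open>From averages over intervals to a pointwise relation\<close>

lemma rv_order_stat_2_4 [measurable]: "random_variable borel (order_stat 2 4 X)"
proof -
  have eq: "order_stat 2 4 X = (\<lambda>\<omega>. min (max (min (X 1 \<omega>) (X 2 \<omega>)) (min (X 3 \<omega>) (X 4 \<omega>)))
      (min (max (X 1 \<omega>) (X 2 \<omega>)) (max (X 3 \<omega>) (X 4 \<omega>))))"
    using sort_4_second by (simp add: order_stat_4 fun_eq_iff)
  show ?thesis unfolding eq by measurable
qed

text \<open>Integrate the decomposition, valid almost surely as ties have probability 0. In six
  terms the smallest index is 1 or 2 and the second smallest is any other one; each has expectation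
  \<open>a\<close>. In two terms 3 and 4 are the two smallest indices; each has expectation
  \<open>b\<close>. Hence \<open>2 * b - 6 * a = 0\<close>.\<close>

lemma expectation_second_of_4:
  defines "Y \<equiv> order_stat 2 4 X"
  assumes zero: "expectation (\<lambda>\<omega>. (min (X 1 \<omega>) (X 2 \<omega>) - Y \<omega>) * indicator {c<..<d} (Y \<omega>)) = 0"
  defines "\<phi> \<equiv> indicator {c<..<d} :: real \<Rightarrow> real"
  shows "expectation (\<lambda>\<omega>. \<phi> (X 1 \<omega>) * (F (X 1 \<omega>) * K (X 1 \<omega>) - 3 * (G (X 1 \<omega>) * (1 - F (X 1 \<omega>))\<^sup>2))) = 0"
    and "integrable M (\<lambda>\<omega>. \<phi> (X 1 \<omega>) * (F (X 1 \<omega>) * K (X 1 \<omega>) - 3 * (G (X 1 \<omega>) * (1 - F (X 1 \<omega>))\<^sup>2)))"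
proof -
  define A where "A i j k l \<omega> = \<phi> (X j \<omega>) * (max 0 (X j \<omega> - X i \<omega>) *
      (if X j \<omega> < X k \<omega> then 1 else 0) * (if X j \<omega> < X l \<omega> then 1 else 0))" for i j k l \<omega>
  define B where "B i j \<omega> = \<phi> (X j \<omega>) * ((if X i \<omega> < X j \<omega> then 1 else 0) *
      max 0 (min (X 1 \<omega>) (X 2 \<omega>) - X j \<omega>))" for i j \<omega>
  have [measurable]: "\<phi> \<in> borel_measurable borel" by (simp add: \<phi>_def)
  \<comment> \<open>The bounded test interval makes every piece integrable separately:
    \<open>X j \<omega> < d\<close> bounds the distance down to \<open>X i\<close>, and in
    \<open>intB\<close> likewise \<open>c < X j \<omega>\<close> bounds the distance up to the
    minimum.\<close>
  have intA: "integrable M (A i j k l)" if ijkl: "i \<in> {1..4}" "j \<in> {1..4}" "k \<in> {1..4}" "l \<in> {1..4}" for i j k l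
  proof (rule Bochner_Integration.integrable_bound[OF integrable_pos_part[OF ijkl(1), of d]])
    note [measurable] = rv[OF ijkl(1)] rv[OF ijkl(2)] rv[OF ijkl(3)] rv[OF ijkl(4)]
    show "random_variable borel (A i j k l)" unfolding A_def[abs_def] by measurable
    show "AE \<omega> in M. norm (A i j k l \<omega>) \<le> norm (max 0 (d - X i \<omega>))"
      by (intro AE_I2) (auto simp: A_def \<phi>_def indicator_def)
  qed
  have intB: "integrable M (B i j)" if ij: "i \<in> {1..4}" "j \<in> {1..4}" for i j
  proof (rule Bochner_Integration.integrable_bound[OF integrable_max_min(1)[of c]])
    note [measurable] = rv[OF ij(1)] rv[OF ij(2)]
    show "random_variable borel (B i j)" unfolding B_def[abs_def] by measurable
    show "AE \<omega> in M. norm (B i j \<omega>) \<le> norm (max 0 (min (X 1 \<omega>) (X 2 \<omega>) - c))"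
      by (intro AE_I2) (auto simp: B_def \<phi>_def indicator_def)
  qed
  define a where "a = expectation (\<lambda>\<omega>. \<phi> (X 1 \<omega>) * (G (X 1 \<omega>) * (1 - F (X 1 \<omega>))\<^sup>2))"
  define b where "b = expectation (\<lambda>\<omega>. \<phi> (X 1 \<omega>) * (F (X 1 \<omega>) * K (X 1 \<omega>)))"
  have A: "expectation (A i j k l) = a" "integrable M (\<lambda>\<omega>. \<phi> (X 1 \<omega>) * (G (X 1 \<omega>) * (1 - F (X 1 \<omega>))\<^sup>2))"
    if "i \<in> {1..4}" "j \<in> {1..4}" "k \<in> {1..4}" "l \<in> {1..4}" "distinct [i, j, k, l]" for i j k l
    unfolding a_def A_def[abs_def]
    by (rule expectation_below(1)[OF that], simp, use intA[OF that(1-4)] in \<open>simp add: A_def[abs_def]\<close>)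
       (rule expectation_below(2)[OF that], simp, use intA[OF that(1-4)] in \<open>simp add: A_def[abs_def]\<close>)
  have B: "expectation (B i j) = b" "integrable M (\<lambda>\<omega>. \<phi> (X 1 \<omega>) * (F (X 1 \<omega>) * K (X 1 \<omega>)))"
    if "i \<in> {1..4}" "j \<in> {1..4}" "distinct [i, j, 1, 2]" for i j
    unfolding b_def B_def[abs_def]
    by (rule expectation_above(1)[OF that], simp, use intB[OF that(1-2)] in \<open>simp add: B_def[abs_def]\<close>)
       (rule expectation_above(2)[OF that], simp, use intB[OF that(1-2)] in \<open>simp add: B_def[abs_def]\<close>)
  have "AE \<omega> in M. (min (X 1 \<omega>) (X 2 \<omega>) - Y \<omega>) * \<phi> (Y \<omega>) = B 4 3 \<omega> + B 3 4 \<omega> -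
    (A 2 1 3 4 \<omega> + A 1 2 3 4 \<omega> + A 1 3 2 4 \<omega> + A 2 3 1 4 \<omega> + A 1 4 2 3 \<omega> + A 2 4 1 3 \<omega>)"
    using AE_X_distinct
  proof eventually_elim
    case (elim \<omega>)
    from second_of_4_decomposition[OF elim, of \<phi>] show ?case
      by (simp only: Y_def order_stat_4 A_def B_def) simp
  qed
  then have "expectation (\<lambda>\<omega>. (min (X 1 \<omega>) (X 2 \<omega>) - Y \<omega>) * \<phi> (Y \<omega>)) = expectation (\<lambda>\<omega>. B 4 3 \<omega> + B 3 4 \<omega> -
    (A 2 1 3 4 \<omega> + A 1 2 3 4 \<omega> + A 1 3 2 4 \<omega> + A 2 3 1 4 \<omega> + A 1 4 2 3 \<omega> + A 2 4 1 3 \<omega>))"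
    by (intro integral_cong_AE borel_measurable_integrable[OF Bochner_Integration.integrable_diff]
          Bochner_Integration.integrable_add intA intB)
       (simp_all add: Y_def \<phi>_def)
  also have "\<dots> = 2 * b - 6 * a"
    by (simp add: intA intB A B)
  finally have ba: "b = 3 * a"
    using zero by (simp add: \<phi>_def)
  have ia: "integrable M (\<lambda>\<omega>. \<phi> (X 1 \<omega>) * (G (X 1 \<omega>) * (1 - F (X 1 \<omega>))\<^sup>2))"
    using A(2)[of 1 2 3 4] by simp
  have ib: "integrable M (\<lambda>\<omega>. \<phi> (X 1 \<omega>) * (F (X 1 \<omega>) * K (X 1 \<omega>)))"
    using B(2)[of 3 4] by simp
  have eq: "(\<lambda>\<omega>. \<phi> (X 1 \<omega>) * (F (X 1 \<omega>) * K (X 1 \<omega>) - 3 * (G (X 1 \<omega>) * (1 - F (X 1 \<omega>))\<^sup>2))) =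
    (\<lambda>\<omega>. \<phi> (X 1 \<omega>) * (F (X 1 \<omega>) * K (X 1 \<omega>)) - 3 * (\<phi> (X 1 \<omega>) * (G (X 1 \<omega>) * (1 - F (X 1 \<omega>))\<^sup>2)))"
    by (simp add: fun_eq_iff algebra_simps)
  show "expectation (\<lambda>\<omega>. \<phi> (X 1 \<omega>) * (F (X 1 \<omega>) * K (X 1 \<omega>) - 3 * (G (X 1 \<omega>) * (1 - F (X 1 \<omega>))\<^sup>2))) = 0"
    unfolding eq by (subst Bochner_Integration.integral_diff) (use ia ib ba in \<open>simp_all add: a_def b_def del: One_nat_def\<close>)
  show "integrable M (\<lambda>\<omega>. \<phi> (X 1 \<omega>) * (F (X 1 \<omega>) * K (X 1 \<omega>) - 3 * (G (X 1 \<omega>) * (1 - F (X 1 \<omega>))\<^sup>2)))"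
    unfolding eq using ia ib by simp
qed

text \<open>If \<open>h y\<close> were positive, \<open>h\<close> would be positive on a whole
  interval around \<open>y\<close> by continuity. A vanishing integral over it forces
  \<open>X 1\<close> to avoid the interval almost surely, which contradicts the strict growth of
  \<open>F\<close> there. The one-sided form is meant for use with both \<open>h\<close> and
  \<open>- h\<close>.\<close>

lemma nonpos_if_expectations_zero:
  fixes h :: "real \<Rightarrow> real"
  assumes mono: "strict_mono_on {x. 0 < F x \<and> F x < 1} F" and y: "0 < F y" "F y < 1"
    and h: "continuous_on UNIV h"
    and int: "\<And>c d. integrable M (\<lambda>\<omega>. indicator {c<..<d} (X 1 \<omega>) * h (X 1 \<omega>))"
    and zero: "\<And>c d. expectation (\<lambda>\<omega>. indicator {c<..<d} (X 1 \<omega>) * h (X 1 \<omega>)) = 0"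
  shows "h y \<le> 0"
proof (rule ccontr)
  assume "\<not> h y \<le> 0"
  have "open {x. 0 < h x \<and> 0 < F x \<and> F x < 1}"
    by (intro open_Collect_conj open_Collect_less continuous_intros cont h)
  moreover have "y \<in> {x. 0 < h x \<and> 0 < F x \<and> F x < 1}" using \<open>\<not> h y \<le> 0\<close> y by simp
  ultimately obtain e where e: "e > 0" "ball y e \<subseteq> {x. 0 < h x \<and> 0 < F x \<and> F x < 1}"
    using open_contains_ball by blast
  have pos: "0 < h x \<and> 0 < F x \<and> F x < 1" if "y - e < x" "x < y + e" for x
  proof -
    have "x \<in> ball y e" using that by (auto simp: dist_real_def)
    with e(2) show ?thesis by blast
  qed
  have "AE \<omega> in M. indicator {y - e<..<y + e} (X 1 \<omega>) * h (X 1 \<omega>) = 0"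
    using zero[of "y - e" "y + e"]
    by (subst (asm) integral_nonneg_eq_0_iff_AE[OF int]) (intro AE_I2, auto simp: indicator_def dest: pos)
  \<comment> \<open>The point \<open>y + e / 2\<close> is still interior to the interval, so no mass
    between it and \<open>y\<close> means \<open>F (y + e / 2) \<le> F y\<close>.\<close>
  then have "AE \<omega> in M. X 1 \<omega> \<le> y + e / 2 \<longrightarrow> X 1 \<omega> \<le> y"
  proof eventually_elim
    case (elim \<omega>)
    show ?case
    proof (intro impI leI notI)
      assume "X 1 \<omega> \<le> y + e / 2" "y < X 1 \<omega>"
      with e(1) have "y - e < X 1 \<omega>" "X 1 \<omega> < y + e" by auto
      with elim pos[of "X 1 \<omega>"] show False by simp
    qed
  qed
  then have "prob {\<omega> \<in> space M. X 1 \<omega> \<le> y + e / 2} \<le> prob {\<omega> \<in> space M. X 1 \<omega> \<le> y}"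
    by (intro finite_measure_mono_AE) auto
  then have "F (y + e / 2) \<le> F y" by (simp add: prob_X_le)
  moreover have "F y < F (y + e / 2)"
    using e(1) pos[of "y + e / 2"] y by (intro strict_mono_onD[OF mono]) auto
  ultimately show False by simp
qed

lemma quantile_derivative:
  assumes mono: "strict_mono_on {x. 0 < F x \<and> F x < 1} F"
    and zero: "\<And>c d. expectation (\<lambda>\<omega>. (min (X 1 \<omega>) (X 2 \<omega>) - order_stat 2 4 X \<omega>) *
      indicator {c<..<d} (order_stat 2 4 X \<omega>)) = 0"
  shows "\<exists>c>0. \<forall>u\<in>{0<..<1}. (the_inv_into {x. 0 < F x \<and> F x < 1} F has_real_derivative
           c * ((1 + u) / (u powr (5/4) * (1 - u) powr (5/2)))) (at u)"
proof (rule quantile_derivative_ODE[OF _ DERIV_G DERIV_K])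
  let ?S = "{x. 0 < F x \<and> F x < 1}"
  show "the_inv_into ?S F u \<in> ?S \<and> F (the_inv_into ?S F u) = u \<and> isCont (the_inv_into ?S F) u"
    if "0 < u" "u < 1" for u
    using strict_mono_cdf_inverse[OF cont mono F_lim that] by blast
  show "0 < G x" if "x \<in> ?S" for x using that by (simp add: G_pos)
  show "F x * K x = 3 * (1 - F x)\<^sup>2 * G x" if "x \<in> ?S" for x
  proof -
    define h where "h x = F x * K x - 3 * (G x * (1 - F x)\<^sup>2)" for x
    have cont_h: "continuous_on UNIV h"
      unfolding h_def
      by (intro continuous_intros cont DERIV_continuous_on[OF DERIV_G] DERIV_continuous_on[OF DERIV_K])
    note E = expectation_second_of_4[OF zero, folded h_def]
    have "h x \<le> 0"
      by (rule nonpos_if_expectations_zero[OF mono]) (use that cont_h E in auto)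
    moreover have "- h x \<le> 0"
      by (rule nonpos_if_expectations_zero[OF mono]) (use that cont_h E in \<open>auto intro: continuous_intros\<close>)
    ultimately show ?thesis by (simp add: h_def mult_ac)
  qed
qed

end

end

section \<open>From the conditional expectation to test sets\<close>

lemma (in prob_space) cond_exp_given_eq_self:
  assumes Z: "integrable M Z" and Y [measurable]: "random_variable borel Y" and A: "A \<in> sets borel"
    and eq: "AE \<omega> in M. cond_exp_given M Z Y \<omega> = Y \<omega>"
  shows "expectation (\<lambda>\<omega>. (Z \<omega> - Y \<omega>) * indicator A (Y \<omega>)) = 0"
proof -
  define S where "S = vimage_algebra (space M) Y borel"
  interpret finite_measure_subalgebra M S
    by unfold_locales (auto simp: subalgebra_def S_def sets_vimage_algebra2 intro: measurable_sets)
  have E: "integrable M (real_cond_exp M S Z)" using Z by (rule real_cond_exp_int(1))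
  \<comment> \<open>Integrability of \<open>Y\<close> is inherited from the conditional expectation
    of \<open>Z\<close>, with which it agrees almost everywhere.\<close>
  have intY: "integrable M Y"
    using E eq unfolding cond_exp_given_def S_def[symmetric]
    by (subst integrable_cong_AE[of _ _ "real_cond_exp M S Z"]) auto
  have set: "Y -` A \<inter> space M \<in> sets S"
    unfolding S_def using A by (rule in_vimage_algebra)
  have meas: "Y -` A \<inter> space M \<in> sets M" using A by measurable
  have i: "integrable M (\<lambda>\<omega>. indicator (Y -` A \<inter> space M) \<omega> * W \<omega>)" if "integrable M W" for W :: "'a \<Rightarrow> real"
    using integrable_mult_indicator[OF meas that] by simp
  have "expectation (\<lambda>\<omega>. (Z \<omega> - Y \<omega>) * indicator A (Y \<omega>)) =
      expectation (\<lambda>\<omega>. indicator (Y -` A \<inter> space M) \<omega> * Z \<omega> - indicator (Y -` A \<inter> space M) \<omega> * Y \<omega>)"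
    by (intro Bochner_Integration.integral_cong) (auto simp: indicator_def)
  also have "\<dots> = expectation (\<lambda>\<omega>. indicator (Y -` A \<inter> space M) \<omega> * Z \<omega>)
      - expectation (\<lambda>\<omega>. indicator (Y -` A \<inter> space M) \<omega> * Y \<omega>)"
    by (intro Bochner_Integration.integral_diff i Z intY)
  \<comment> \<open>On a set of the sigma-algebra generated by \<open>Y\<close>, first replace
    \<open>Y\<close> by the conditional expectation, then use the averaging property that defines
    the latter.\<close>
  also have "expectation (\<lambda>\<omega>. indicator (Y -` A \<inter> space M) \<omega> * Y \<omega>) =
      expectation (\<lambda>\<omega>. indicator (Y -` A \<inter> space M) \<omega> * real_cond_exp M S Z \<omega>)"
    using i[OF intY] i[OF E] eq unfolding cond_exp_given_def S_def[symmetric]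
    by (intro integral_cong_AE) auto
  also have "\<dots> = expectation (\<lambda>\<omega>. indicator (Y -` A \<inter> space M) \<omega> * Z \<omega>)"
    using real_cond_exp_intA[OF Z set] by (simp add: set_lebesgue_integral_def)
  finally show ?thesis by simp
qed

section \<open>Reflection, and the two statements in terms of \<open>F\<close>\<close>

context iid_sample
begin

text \<open>The law of the negated variable has distribution function \<open>x\<close> mapped to the
  probability of \<open>X i \<omega> \<ge> - x\<close>, which is \<open>1 - F (- x)\<close> because
  there are no atoms.\<close>

lemma reflect: "iid_sample M (\<lambda>i \<omega>. - X i \<omega>) (\<lambda>x. 1 - F (- x))"
proof
  show "indep_vars (\<lambda>_. borel) (\<lambda>i \<omega>. - X i \<omega>) {1..4}"
    by (rule indep_vars_compose2[OF indep]) auto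
  show "continuous_on UNIV (\<lambda>x. 1 - F (- x))"
    by (intro continuous_intros continuous_on_compose2[OF cont]) auto
  show "cdf (distr M borel (\<lambda>\<omega>. - X i \<omega>)) = (\<lambda>x. 1 - F (- x))" if i: "i \<in> {1..4}" for i
  proof
    fix x
    note [measurable] = rv[OF i]
    have "cdf (distr M borel (\<lambda>\<omega>. - X i \<omega>)) x = prob {\<omega> \<in> space M. - x \<le> X i \<omega>}"
      unfolding cdf_def by (subst measure_distr) (auto intro!: arg_cong[where f=prob])
    then show "cdf (distr M borel (\<lambda>\<omega>. - X i \<omega>)) x = 1 - F (- x)"
      using prob_X_ge[OF i] by simp
  qed
qed

lemma order_stat_uminus: "order_stat 2 4 (\<lambda>i \<omega>. - X i \<omega>) = (\<lambda>\<omega>. - order_stat 3 4 X \<omega>)"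
  using sort_4_uminus by (simp add: order_stat_4 fun_eq_iff)

theorem quantile_derivative_min:
  assumes mono: "strict_mono_on {x. 0 < F x \<and> F x < 1} F"
    and int: "integrable M (order_stat 1 2 X)"
    and eq: "AE \<omega> in M. cond_exp_given M (order_stat 1 2 X) (order_stat 2 4 X) \<omega> = order_stat 2 4 X \<omega>"
  shows "\<exists>c>0. \<forall>u\<in>{0<..<1}. (the_inv_into {x. 0 < F x \<and> F x < 1} F has_real_derivative
           c * ((1 + u) / (u powr (5/4) * (1 - u) powr (5/2)))) (at u)"
proof (rule quantile_derivative[OF _ mono])
  have min: "order_stat 1 2 X = (\<lambda>\<omega>. min (X 1 \<omega>) (X 2 \<omega>))"
    by (rule ext) (rule order_stat_1_2)
  show *: "integrable M (\<lambda>\<omega>. min (X 1 \<omega>) (X 2 \<omega>))" using int unfolding min .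
  show "expectation (\<lambda>\<omega>. (min (X 1 \<omega>) (X 2 \<omega>) - order_stat 2 4 X \<omega>) *
      indicator {c<..<d} (order_stat 2 4 X \<omega>)) = 0" for c d
    using cond_exp_given_eq_self[OF int _ _ eq, of "{c<..<d}"] rv_order_stat_2_4[OF *]
    unfolding order_stat_1_2 by auto
qed

theorem quantile_derivative_max:
  assumes mono: "strict_mono_on {x. 0 < F x \<and> F x < 1} F"
    and int: "integrable M (order_stat 2 2 X)"
    and eq: "AE \<omega> in M. cond_exp_given M (order_stat 2 2 X) (order_stat 3 4 X) \<omega> = order_stat 3 4 X \<omega>"
  shows "\<exists>c>0. \<forall>u\<in>{0<..<1}. (the_inv_into {x. 0 < F x \<and> F x < 1} F has_real_derivative
           c * ((2 - u) / (u powr (5/2) * (1 - u) powr (5/4)))) (at u)"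
proof -
  interpret R: iid_sample M "\<lambda>i \<omega>. - X i \<omega>" "\<lambda>x. 1 - F (- x)" by (rule reflect)
  let ?S = "{x. 0 < F x \<and> F x < 1}" and ?R = "{x. 0 < 1 - F (- x) \<and> 1 - F (- x) < 1}"
  let ?Y = "order_stat 3 4 X"
  have max: "(\<lambda>\<omega>. min (- X 1 \<omega>) (- X 2 \<omega>)) = (\<lambda>\<omega>. - order_stat 2 2 X \<omega>)"
    unfolding order_stat_2_2 by (simp add: minus_max_eq_min)
  have int': "integrable M (\<lambda>\<omega>. min (- X 1 \<omega>) (- X 2 \<omega>))" using int unfolding max by simp
  have [measurable]: "random_variable borel ?Y"
    using R.rv_order_stat_2_4[OF int'] unfolding order_stat_uminus by simp
  have mono': "strict_mono_on ?R (\<lambda>x. 1 - F (- x))"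
    by (intro strict_mono_onI) (auto intro: strict_mono_onD[OF mono])
  have "\<exists>c>0. \<forall>u\<in>{0<..<1}. (the_inv_into ?R (\<lambda>x. 1 - F (- x)) has_real_derivative
           c * ((1 + u) / (u powr (5/4) * (1 - u) powr (5/2)))) (at u)"
  proof (rule R.quantile_derivative[OF int' mono'])
    fix c d :: real
    \<comment> \<open>Under negation the test interval from \<open>c\<close> to \<open>d\<close>
      becomes the one from \<open>- d\<close> to \<open>- c\<close>, and the difference changes
      sign.\<close>
    have "expectation (\<lambda>\<omega>. (min (- X 1 \<omega>) (- X 2 \<omega>) - order_stat 2 4 (\<lambda>i \<omega>. - X i \<omega>) \<omega>) *
        indicator {c<..<d} (order_stat 2 4 (\<lambda>i \<omega>. - X i \<omega>) \<omega>)) =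
      expectation (\<lambda>\<omega>. - ((order_stat 2 2 X \<omega> - ?Y \<omega>) * indicator {- d<..<- c} (?Y \<omega>)))"
      unfolding order_stat_uminus fun_cong[OF max]
      by (intro Bochner_Integration.integral_cong) (auto simp: indicator_def)
    also have "\<dots> = 0"
      using cond_exp_given_eq_self[OF int _ _ eq, of "{- d<..<- c}"] by simp
    finally show "expectation (\<lambda>\<omega>. (min (- X 1 \<omega>) (- X 2 \<omega>) - order_stat 2 4 (\<lambda>i \<omega>. - X i \<omega>) \<omega>) *
        indicator {c<..<d} (order_stat 2 4 (\<lambda>i \<omega>. - X i \<omega>) \<omega>)) = 0" .
  qed
  then obtain c where c: "c > 0" and der: "\<And>u. 0 < u \<Longrightarrow> u < 1 \<Longrightarrow>
      (the_inv_into ?R (\<lambda>x. 1 - F (- x)) has_real_derivative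
           c * ((1 + u) / (u powr (5/4) * (1 - u) powr (5/2)))) (at u)"
    by auto
  \<comment> \<open>The quantile function of the negated variable at \<open>1 - u\<close> is minus
    the original one at \<open>u\<close>. Differentiating, the two signs cancel, and
    \<open>u\<close> and \<open>1 - u\<close> trade places in the formula.\<close>
  have flip: "the_inv_into ?S F u = - the_inv_into ?R (\<lambda>x. 1 - F (- x)) (1 - u)" if u: "0 < u" "u < 1" for u
  proof (rule the_inv_into_f_eq[OF strict_mono_on_imp_inj_on[OF mono]])
    have "0 < 1 - u" "1 - u < 1" using u by auto
    note inv = strict_mono_cdf_inverse(1,2)[OF R.cont mono' R.F_lim this]
    from inv(1) show "- the_inv_into ?R (\<lambda>x. 1 - F (- x)) (1 - u) \<in> ?S" by simp
    from inv(2) show "F (- the_inv_into ?R (\<lambda>x. 1 - F (- x)) (1 - u)) = u" by simp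
  qed
  have "(the_inv_into ?S F has_real_derivative c * ((2 - u) / (u powr (5/2) * (1 - u) powr (5/4)))) (at u)"
    if u: "0 < u" "u < 1" for u
  proof (rule has_field_derivative_transform_within_open)
    have "((\<lambda>v. - the_inv_into ?R (\<lambda>x. 1 - F (- x)) (1 - v)) has_real_derivative
        - (c * ((1 + (1 - u)) / ((1 - u) powr (5/4) * (1 - (1 - u)) powr (5/2))) * (- 1))) (at u)"
      by (intro DERIV_minus DERIV_chain2[OF der] derivative_eq_intros) (use u in auto)
    then show "((\<lambda>v. - the_inv_into ?R (\<lambda>x. 1 - F (- x)) (1 - v)) has_real_derivative
        c * ((2 - u) / (u powr (5/2) * (1 - u) powr (5/4)))) (at u)"
      by (simp add: mult.commute)
  qed (use u flip in \<open>auto intro: open_greaterThanLessThan\<close>)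
  with c show ?thesis by auto
qed

end

section \<open>From the positive density to a continuous, strictly increasing distribution
  function\<close>

theorem corollary3p6:
  fixes M :: "'a measure" and X :: "nat \<Rightarrow> 'a \<Rightarrow> real"
    and f F :: "real \<Rightarrow> real" and a b :: ereal
  assumes "prob_space M"
    and indep: "prob_space.indep_vars M (\<lambda>_. borel) X {1..4}"
    and dens_nonneg: "\<And>x. 0 \<le> f x"
    and dens: "\<And>i. i \<in> {1..4} \<Longrightarrow> distributed M lborel (X i) (\<lambda>x. ennreal (f x))"
    and cdf: "\<And>i. i \<in> {1..4} \<Longrightarrow> F = cdf (distr M borel (X i))"
    and supp: "\<And>i. i \<in> {1..4} \<Longrightarrow> AE \<omega> in M. X i \<omega> \<in> einterval a b"
    and dens_pos: "\<And>x. x \<in> einterval a b \<Longrightarrow> 0 < f x"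
  shows "(integrable M (order_stat 1 2 X) \<and>
          (AE \<omega> in M. cond_exp_given M (order_stat 1 2 X) (order_stat 2 4 X) \<omega> = order_stat 2 4 X \<omega>)
          \<longrightarrow> (\<exists>c>0. \<forall>u\<in>{0<..<1}.
                (quantile_fun F a b has_real_derivative
                  c * ((1 + u) / (u powr (5/4) * (1 - u) powr (5/2)))) (at u)))
       \<and> (integrable M (order_stat 2 2 X) \<and>
          (AE \<omega> in M. cond_exp_given M (order_stat 2 2 X) (order_stat 3 4 X) \<omega> = order_stat 3 4 X \<omega>)
          \<longrightarrow> (\<exists>c>0. \<forall>u\<in>{0<..<1}.
                (quantile_fun F a b has_real_derivative
                  c * ((2 - u) / (u powr (5/2) * (1 - u) powr (5/4)))) (at u)))"
proof -
  interpret prob_space M by fact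
  have X1: "distributed M lborel (X 1) (\<lambda>x. ennreal (f x))" using dens by simp
  have [measurable]: "random_variable borel (X 1)" "random_variable borel (X (Suc 0))"
    using distributed_measurable[OF X1] by simp_all
  have [measurable]: "f \<in> borel_measurable borel" using distributed_real_measurable[OF _ X1] dens_nonneg by simp
  interpret D: real_distribution "distr M borel (X 1)" by (rule real_distribution_distr) simp
  have F: "F x = prob {\<omega> \<in> space M. X 1 \<omega> \<le> x}" for x
    using cdf[of 1] unfolding cdf_def
    by (simp add: measure_distr vimage_def Int_def conj_commute del: One_nat_def)
  \<comment> \<open>A law with a density gives mass 0 to points, and a distribution function is
    continuous exactly where there is no atom.\<close>
  have "continuous_on UNIV F"
  proof -
    have "emeasure (distr M borel (X 1)) {x} = 0" for x
    proof -
      have "emeasure (distr M borel (X 1)) {x} = (\<integral>\<^sup>+t. ennreal (f t) * indicator {x} t \<partial>lborel)"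
        using distributed_emeasure[OF X1, of "{x}"] by (simp add: emeasure_distr)
      also have "\<dots> = 0" by (rule nn_integral_null_set) (simp add: null_sets_def)
      finally show ?thesis .
    qed
    then show ?thesis
      using cdf[of 1] D.isCont_cdf by (simp add: continuous_on_eq_continuous_at measure_def)
  qed
  then interpret iid_sample M X F
    by unfold_locales (use indep cdf in auto)
  \<comment> \<open>Were \<open>F\<close> constant between \<open>x\<close> and \<open>y\<close>,
    the density would integrate to 0 over \<open>{x<..y}\<close>; being positive there, it would
    make this interval Lebesgue-null.\<close>
  have mono: "F x < F y" if xy: "x \<in> einterval a b" "y \<in> einterval a b" "x < y" for x y
  proof (rule ccontr)
    assume "\<not> F x < F y"
    have sub: "{x<..y} \<subseteq> einterval a b"
      using xy by (auto simp: einterval_def intro: less_trans[of a "ereal x"] le_less_trans[of _ "ereal y" b])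
    have "measure (distr M borel (X 1)) {x<..y} = F y - F x"
      using D.cdf_diff_eq[OF xy(3)] cdf[of 1] by simp
    then have "measure (distr M borel (X 1)) {x<..y} = 0"
      using \<open>\<not> F x < F y\<close> measure_nonneg[of "distr M borel (X 1)" "{x<..y}"] by simp
    then have "emeasure (distr M borel (X 1)) {x<..y} = 0"
      by (simp add: D.emeasure_eq_measure del: One_nat_def)
    then have "(\<integral>\<^sup>+t. ennreal (f t) * indicator {x<..y} t \<partial>lborel) = 0"
      using distributed_emeasure[OF X1, of "{x<..y}"] by (simp add: emeasure_distr)
    then have "AE t in lborel. ennreal (f t) * indicator {x<..y} t = 0"
      by (subst (asm) nn_integral_0_iff_AE) auto
    then have "AE t in lborel. t \<notin> {x<..y}"
    proof eventually_elim
      case (elim t)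
      show ?case
      proof
        assume t: "t \<in> {x<..y}"
        with sub dens_pos have "0 < f t" by blast
        with elim t show False by simp
      qed
    qed
    then have "emeasure lborel {x<..y} = 0"
      by (subst (asm) AE_iff_measurable[of "{x<..y}"]) auto
    with xy show False by simp
  qed
  \<comment> \<open>This identifies the domain in \<open>quantile_fun\<close> with the set used so
    far. Outside the interval the support condition makes \<open>F\<close> equal to 0 or 1; inside,
    strict growth towards a neighbour on each side keeps it strictly between.\<close>
  have S: "{x. 0 < F x \<and> F x < 1} = einterval a b"
  proof (intro equalityI subsetI)
    fix x assume "x \<in> {x. 0 < F x \<and> F x < 1}"
    then have x: "0 < F x" "F x < 1" by auto
    show "x \<in> einterval a b"
    proof (rule ccontr)
      assume "x \<notin> einterval a b"
      then consider "ereal x \<le> a" | "b \<le> ereal x" by (auto simp: einterval_def not_less)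
      then show False
      proof cases
        case 1
        have "AE \<omega> in M. \<not> X 1 \<omega> \<le> x"
          using supp[of 1, simplified] by eventually_elim (use 1 in \<open>auto simp: einterval_def dest: le_less_trans\<close>)
        then have "prob {\<omega> \<in> space M. X 1 \<omega> \<le> x} = 0" by (subst prob_eq_0) auto
        with x F show False by simp
      next
        case 2
        have "AE \<omega> in M. X 1 \<omega> \<le> x"
          using supp[of 1, simplified] by eventually_elim (use 2 in \<open>auto simp: einterval_def dest: less_le_trans\<close>)
        then have "prob {\<omega> \<in> space M. X 1 \<omega> \<le> x} = 1" by (subst prob_Collect_eq_1) auto
        with x F show False by simp
      qed
    qed
  next
    fix x assume x: "x \<in> einterval a b"
    obtain e where e: "e > 0" "ball x e \<subseteq> einterval a b"
      using open_einterval x open_contains_ball by blast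
    then have "x - e/2 \<in> einterval a b" "x + e/2 \<in> einterval a b"
      by (auto simp: subset_eq dist_real_def)
    then have "F (x - e/2) < F x" "F x < F (x + e/2)" using x e(1) by (auto intro!: mono)
    moreover have "0 \<le> F (x - e/2)" "F (x + e/2) \<le> 1" by (simp_all add: F)
    ultimately show "x \<in> {x. 0 < F x \<and> F x < 1}" by simp
  qed
  have sm: "strict_mono_on {x. 0 < F x \<and> F x < 1} F"
    unfolding S by (intro strict_mono_onI mono)
  show ?thesis
    unfolding quantile_fun_def S[symmetric]
    using quantile_derivative_min[OF sm] quantile_derivative_max[OF sm] by blast
qed

end
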